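(* The game of tic-tac-toe played on the affine plane of order $4$, $\pi_4$, is a first player win: the first player has a strategy that guarantees that he is the first to occupy all points of some line, regardless of how the second player plays.
   Context: An affine plane of order $n$ is a set of $n^2$ points together with $n(n+1)$ lines, each line a set of $n$ points, such that any two distinct points lie on exactly one common line; the lines partition into $n+1$ parallel classes, each partitioning the point set. The affine plane of order $4$, $\pi_4$ (16 points, 20 lines of 4 points each, 5 parallel classes), is unique up to isomorphism. Tic-tac-toe on $\pi_4$: two players alternately choose previously unchosen points, the first player moving first; a player wins as soon as he or she has chosen all points of some line; if all points are chosen without a win the game is a draw. *)

theory Defs
  imports Main "HOL-Library.Disjoint_Sets"
begin

definition affine_plane :: "nat \<Rightarrow> 'a set \<Rightarrow> 'a set set \<Rightarrow> bool" where
  "affine_plane n P L \<longleftrightarrow>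
     finite P \<and> card P = n\<^sup>2 \<and>
     finite L \<and> card L = n * (n + 1) \<and>
     (\<forall>l\<in>L. l \<subseteq> P \<and> card l = n) \<and>
     (\<forall>p\<in>P. \<forall>q\<in>P. p \<noteq> q \<longrightarrow> (\<exists>!l. l \<in> L \<and> p \<in> l \<and> q \<in> l)) \<and>
     (\<exists>C. partition_on L C \<and> card C = n + 1 \<and> (\<forall>c\<in>C. partition_on P c))"

text \<open>
  A history lists the chosen points in the order in which they were chosen. Indices start at 0,
  so the first player owns the entries at even indices and the second player those at odd indices.
\<close>

definition first_points :: "'a list \<Rightarrow> 'a set" where
  "first_points h = {h ! i | i. i < length h \<and> even i}"

definition second_points :: "'a list \<Rightarrow> 'a set" where
  "second_points h = {h ! i | i. i < length h \<and> odd i}"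

definition occupies_line :: "'a set set \<Rightarrow> 'a set \<Rightarrow> bool" where
  "occupies_line L S \<longleftrightarrow> (\<exists>l\<in>L. l \<subseteq> S)"

definition game_over :: "'a set \<Rightarrow> 'a set set \<Rightarrow> 'a list \<Rightarrow> bool" where
  "game_over P L h \<longleftrightarrow>
     occupies_line L (first_points h) \<or> occupies_line L (second_points h) \<or> set h = P"

inductive history :: "'a set \<Rightarrow> 'a set set \<Rightarrow> 'a list \<Rightarrow> bool" for P L where
  start: "history P L []"
| move: "history P L h \<Longrightarrow> \<not> game_over P L h \<Longrightarrow> p \<in> P - set h \<Longrightarrow> history P L (h @ [p])"

definition follows :: "('a list \<Rightarrow> 'a) \<Rightarrow> 'a list \<Rightarrow> bool" where
  "follows \<sigma> h \<longleftrightarrow> (\<forall>i<length h. even i \<longrightarrow> h ! i = \<sigma> (take i h))"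

text \<open>
  A history cannot be continued once a line is occupied. Hence a finished game in which the first
  player occupies a line is one in which he is the first to do so, and the second player occupies
  none. The clause on \<open>P - set h\<close> makes the strategy prescribe a legal move whenever the
  first player is to move. Every play ends after at most \<open>card P\<close> moves.
\<close>

definition first_winning_strategy ::
    "'a set \<Rightarrow> 'a set set \<Rightarrow> ('a list \<Rightarrow> 'a) \<Rightarrow> bool" where
  "first_winning_strategy P L \<sigma> \<longleftrightarrow>
     (\<forall>h. history P L h \<and> follows \<sigma> h \<longrightarrow>
        (\<not> game_over P L h \<and> even (length h) \<longrightarrow> \<sigma> h \<in> P - set h) \<and>
        (game_over P L h \<longrightarrow> occupies_line L (first_points h)))"

definition first_player_win :: "'a set \<Rightarrow> 'a set set \<Rightarrow> bool" where
  "first_player_win P L \<longleftrightarrow> (\<exists>\<sigma>. first_winning_strategy P L \<sigma>)"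

text \<open>
  The plane over the field with four elements; the point \<open>(x, y)\<close> is encoded as
  \<open>4 * x + y\<close>, with field elements numbered so that addition is bitwise exclusive or.
\<close>

definition plane4_classes :: "nat set list list" where
  "plane4_classes =
    [[{0,1,2,3}, {4,5,6,7}, {8,9,10,11}, {12,13,14,15}],
     [{0,4,8,12}, {1,5,9,13}, {2,6,10,14}, {3,7,11,15}],
     [{0,5,10,15}, {1,4,11,14}, {2,7,8,13}, {3,6,9,12}],
     [{0,6,11,13}, {1,7,10,12}, {2,4,9,15}, {3,5,8,14}],
     [{0,7,9,14}, {1,6,8,15}, {2,5,11,12}, {3,4,10,13}]]"

lemma affine_plane_4_exists:
  "affine_plane 4 (set [0..<16]) (set (concat plane4_classes))"
proof -
  let ?P = "set [0..<16]" and ?L = "set (concat plane4_classes)"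
    and ?C = "set (map set plane4_classes)"
  have len: "card ?P = 16" "card ?L = 20" by code_simp+
  have lines: "\<forall>l\<in>?L. l \<subseteq> ?P \<and> card l = 4" by code_simp
  have ex: "\<forall>p\<in>?P. \<forall>q\<in>?P. p \<noteq> q \<longrightarrow> (\<exists>l\<in>?L. p \<in> l \<and> q \<in> l)" by code_simp
  have un: "\<forall>l\<in>?L. \<forall>m\<in>?L. l \<noteq> m \<longrightarrow> card (l \<inter> m) \<le> 1" by code_simp
  have uniq: "\<exists>!l. l \<in> ?L \<and> p \<in> l \<and> q \<in> l"
    if pq: "p \<in> ?P" "q \<in> ?P" "p \<noteq> q" for p q
  proof -
    obtain l where l: "l \<in> ?L" "p \<in> l" "q \<in> l" using ex pq by blast
    have "m = l" if m: "m \<in> ?L" "p \<in> m" "q \<in> m" for m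
    proof (rule ccontr)
      assume "m \<noteq> l"
      then have le: "card (m \<inter> l) \<le> 1" using un m(1) l(1) by blast
      have "finite (m \<inter> l)" using lines l(1) by (meson List.finite_set finite_Int finite_subset)
      then have "card {p, q} \<le> card (m \<inter> l)" using l m by (intro card_mono) auto
      then show False using le pq(3) by simp
    qed
    then show ?thesis using l by blast
  qed
  have cov: "\<Union> ?C = ?L" by (auto simp: plane4_classes_def)
  have cc: "card ?C = 5" "{} \<notin> ?C" by code_simp+
  have dC: "\<forall>c\<in>?C. \<forall>d\<in>?C. c \<noteq> d \<longrightarrow> c \<inter> d = {}" by code_simp
  have part: "\<forall>c\<in>?C. \<Union> c = ?P \<and> {} \<notin> c \<and> (\<forall>l\<in>c. \<forall>m\<in>c. l \<noteq> m \<longrightarrow> l \<inter> m = {})"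
    by code_simp
  have "partition_on ?L ?C"
    using cov cc(2) dC by (intro partition_onI) (auto simp: disjnt_def)
  moreover have "partition_on ?P c" if "c \<in> ?C" for c
    using bspec[OF part that] unfolding partition_on_def disjoint_def by blast
  ultimately have "\<exists>C. partition_on ?L C \<and> card C = 4 + 1 \<and> (\<forall>c\<in>C. partition_on ?P c)"
    using cc(1) by (intro exI[of _ ?C] conjI ballI) simp_all
  then show ?thesis
    unfolding affine_plane_def using len lines uniq
    by (intro conjI ballI impI) (simp_all only: List.finite_set, simp_all)
qed

end

theory Submission
  imports Defs
begin

text \<open>
  Let \<open>p\<close> be any opening move and \<open>q\<close> the reply. Two parallel classes, the first being that of the
  line \<open>p q\<close>, together with a line of a third class through \<open>p\<close> put coordinates on the plane for
  which \<open>p\<close> has number 0 and \<open>q\<close> number 1. Each of the other 11 lines is then determined by two of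
  its points and the condition that it meets the rows, the columns and the diagonal at most once.
  So it is enough to win on one explicit plane after the opening 0, 1. There the first player
  continues with 4. The Frobenius automorphism fixes these three points, so only seven of the 13
  replies need a refutation: a tree of moves most of which are threats with a single answer.
\<close>

section \<open>Positional wins\<close>

text \<open>
  The first player owns \<open>A\<close> and the second player owns \<open>B\<close>. It is the first player's turn in
  \<open>wins_moving P L A B\<close> and the second player's turn in \<open>wins_waiting P L A B\<close>.
\<close>

inductive wins_moving wins_waiting :: "'a set \<Rightarrow> 'a set set \<Rightarrow> 'a set \<Rightarrow> 'a set \<Rightarrow> bool"
  for P L where
  move: "p \<in> P - (A \<union> B) \<Longrightarrow> wins_waiting P L (insert p A) B \<Longrightarrow> wins_moving P L A B"
| line: "occupies_line L A \<Longrightarrow> wins_waiting P L A B"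
| reply: "P - (A \<union> B) \<noteq> {} \<Longrightarrow>
    (\<And>q. q \<in> P - (A \<union> B) \<Longrightarrow> \<not> occupies_line L (insert q B)) \<Longrightarrow>
    (\<And>q. q \<in> P - (A \<union> B) \<Longrightarrow> wins_moving P L A (insert q B)) \<Longrightarrow> wins_waiting P L A B"

lemma first_points_eq_set_nths: "first_points h = set (nths h {i. even i})"
  by (simp add: first_points_def set_nths)

lemma second_points_eq_set_nths: "second_points h = set (nths h {i. odd i})"
  by (simp add: second_points_def set_nths)

lemma first_points_append:
  "first_points (h @ [p]) =
     (if even (length h) then insert p (first_points h) else first_points h)"
  by (simp add: first_points_eq_set_nths nths_append)

lemma second_points_append:
  "second_points (h @ [p]) =
     (if odd (length h) then insert p (second_points h) else second_points h)"
  by (simp add: second_points_eq_set_nths nths_append)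

lemma set_eq_first_Un_second: "set h = first_points h \<union> second_points h"
  unfolding first_points_def second_points_def set_conv_nth by blast

lemma follows_append:
  "follows \<sigma> (h @ [p]) \<longleftrightarrow> follows \<sigma> h \<and> (even (length h) \<longrightarrow> p = \<sigma> h)"
  unfolding follows_def by (auto simp: nth_append less_Suc_eq)

definition secured :: "'a set \<Rightarrow> 'a set set \<Rightarrow> 'a list \<Rightarrow> bool" where
  "secured P L h \<longleftrightarrow> \<not> occupies_line L (second_points h) \<and>
     (occupies_line L (first_points h) \<or>
      (if even (length h) then wins_moving P L (first_points h) (second_points h)
       else wins_waiting P L (first_points h) (second_points h)))"

lemma secured_Nil:
  assumes "wins_moving P L {} {}" and "{} \<notin> L"
  shows "secured P L []"
  using assms
  by (auto simp: secured_def first_points_def second_points_def occupies_line_def)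

lemma secured_move:
  assumes "secured P L h" and "\<not> game_over P L h" and "even (length h)"
  shows "\<exists>p \<in> P - set h. secured P L (h @ [p])"
proof -
  have "wins_moving P L (first_points h) (second_points h)"
    using assms by (auto simp: secured_def game_over_def)
  then obtain p where "p \<in> P - set h"
    "wins_waiting P L (insert p (first_points h)) (second_points h)"
    unfolding set_eq_first_Un_second by cases
  then show ?thesis
    using assms(1,3)
    by (auto simp: secured_def first_points_append second_points_append intro!: bexI[of _ p])
qed

lemma secured_reply:
  assumes "secured P L h" and "\<not> game_over P L h" and "odd (length h)" and "p \<in> P - set h"
  shows "secured P L (h @ [p])"
proof -
  have "wins_waiting P L (first_points h) (second_points h)" "\<not> occupies_line L (first_points h)"
    using assms(1-3) by (auto simp: secured_def game_over_def)
  then have "\<not> occupies_line L (insert p (second_points h))"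
    "wins_moving P L (first_points h) (insert p (second_points h))"
    using assms(4) unfolding set_eq_first_Un_second by (cases; blast)+
  then show ?thesis
    using assms(3) by (simp add: secured_def first_points_append second_points_append)
qed

lemma secured_game_over:
  assumes "secured P L h" and "game_over P L h"
  shows "occupies_line L (first_points h)"
proof (rule ccontr)
  assume no_line: "\<not> occupies_line L (first_points h)"
  then have full: "P = first_points h \<union> second_points h"
    using assms by (auto simp: secured_def game_over_def set_eq_first_Un_second)
  have "\<not> wins_moving P L (first_points h) (second_points h)"
    using full by (auto elim: wins_moving.cases)
  moreover have "\<not> wins_waiting P L (first_points h) (second_points h)"
    using full no_line by (auto elim: wins_waiting.cases)
  ultimately show False using assms(1) no_line by (simp add: secured_def split: if_splits)
qed

lemma first_player_win_if_wins_moving: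
  assumes "wins_moving P L {} {}" and "{} \<notin> L"
  shows "first_player_win P L"
proof -
  define \<sigma> where "\<sigma> h = (SOME p. p \<in> P - set h \<and> secured P L (h @ [p]))" for h
  have \<sigma>: "\<sigma> h \<in> P - set h" "secured P L (h @ [\<sigma> h])"
    if "secured P L h" "\<not> game_over P L h" "even (length h)" for h
    using someI_ex[OF secured_move[OF that, unfolded Bex_def]] unfolding \<sigma>_def by simp_all
  have secured: "secured P L h" if "history P L h" "follows \<sigma> h" for h
    using that
  proof (induction rule: history.induct)
    case start
    show ?case using assms by (rule secured_Nil)
  next
    case (move h p)
    then have secured: "secured P L h" by (simp add: follows_append)
    show ?case
    proof (cases "even (length h)")
      case True
      then show ?thesis
        using \<sigma>(2)[OF secured move.hyps(2)] move.prems by (simp add: follows_append)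
    next
      case False
      then show ?thesis using secured_reply[OF secured move.hyps(2) _ move.hyps(3)] by simp
    qed
  qed
  have "first_winning_strategy P L \<sigma>"
    unfolding first_winning_strategy_def
  proof (intro allI impI conjI)
    fix h assume "history P L h \<and> follows \<sigma> h"
    then have "secured P L h" using secured by blast
    then show "\<sigma> h \<in> P - set h" if "\<not> game_over P L h \<and> even (length h)"
      using \<sigma>(1) that by blast
    show "occupies_line L (first_points h)" if "game_over P L h"
      using secured_game_over \<open>secured P L h\<close> that by blast
  qed
  then show ?thesis unfolding first_player_win_def by blast
qed

lemma occupies_line_image:
  assumes "inj_on f P" and "\<Union> L \<subseteq> P" and "A \<subseteq> P"
  shows "occupies_line ((`) f ` L) (f ` A) \<longleftrightarrow> occupies_line L A"
proof -
  have "f ` l \<subseteq> f ` A \<longleftrightarrow> l \<subseteq> A" if "l \<in> L" for l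
    using that assms inj_on_image_mem_iff[of f P _ A] by blast
  then show ?thesis unfolding occupies_line_def by simp
qed

lemma wins_image:
  assumes "inj_on f P" and "\<Union> L \<subseteq> P"
  shows "wins_moving P L A B \<Longrightarrow> A \<subseteq> P \<Longrightarrow> B \<subseteq> P \<Longrightarrow>
      wins_moving (f ` P) ((`) f ` L) (f ` A) (f ` B)"
    and "wins_waiting P L A B \<Longrightarrow> A \<subseteq> P \<Longrightarrow> B \<subseteq> P \<Longrightarrow>
      wins_waiting (f ` P) ((`) f ` L) (f ` A) (f ` B)"
proof (induction rule: wins_moving_wins_waiting.inducts)
  case (move p A B)
  have "f p \<in> f ` P - (f ` A \<union> f ` B)"
    using move inj_on_image_mem_iff[OF assms(1), of p] by blast
  moreover have "wins_waiting (f ` P) ((`) f ` L) (insert (f p) (f ` A)) (f ` B)"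
    using move by auto
  ultimately show ?case by (rule wins_moving_wins_waiting.move)
next
  case (line A B)
  then show ?case
    by (intro wins_moving_wins_waiting.line) (simp add: occupies_line_image[OF assms])
next
  case (reply A B)
  have free: "f ` P - (f ` A \<union> f ` B) = f ` (P - (A \<union> B))"
    using inj_on_image_set_diff[OF assms(1), of P "A \<union> B"] reply.prems by (simp add: image_Un)
  show ?case
  proof (rule wins_moving_wins_waiting.reply; unfold free)
    show "f ` (P - (A \<union> B)) \<noteq> {}" using reply.IH(1) by simp
  next
    fix y assume "y \<in> f ` (P - (A \<union> B))"
    then obtain q where q: "q \<in> P - (A \<union> B)" "y = f q" by blast
    show "\<not> occupies_line ((`) f ` L) (insert y (f ` B))"
      using occupies_line_image[OF assms, of "insert q B"] reply q by simp
    show "wins_moving (f ` P) ((`) f ` L) (f ` A) (insert y (f ` B))"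
      using reply.IH(4)[OF q(1)] reply.prems q by simp
  qed
qed

section \<open>Strategy trees\<close>

text \<open>
  \<open>Node p ts\<close> is the advice to choose \<open>p\<close>; \<open>ts\<close> lists how to go on after those replies that do
  not allow the first player to complete a line at once.
\<close>

datatype 'a strategy_tree = Node 'a "('a \<times> 'a strategy_tree) list"

fun valid_tree :: "'a set \<Rightarrow> 'a set set \<Rightarrow> 'a set \<Rightarrow> 'a set \<Rightarrow> 'a strategy_tree \<Rightarrow> bool" where
  "valid_tree P L A B (Node p ts) \<longleftrightarrow>
     (let A' = insert p A; F = P - (A' \<union> B);
          W = Set.filter (\<lambda>r. occupies_line L (insert r A')) F in
      p \<in> P - (A \<union> B) \<and> F \<noteq> {} \<and> (\<forall>q\<in>F. \<not> occupies_line L (insert q B)) \<and>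
      (\<forall>q\<in>F. W - {q} \<noteq> {} \<or> q \<in> fst ` set ts) \<and>
      (\<forall>(q, t)\<in>set ts. valid_tree P L A' (insert q B) t))"

lemma valid_tree_imp_wins_moving: "valid_tree P L A B t \<Longrightarrow> wins_moving P L A B"
proof (induction P L A B t rule: valid_tree.induct)
  case (1 P L A B p ts)
  define F where "F = P - (insert p A \<union> B)"
  have legal: "p \<in> P - (A \<union> B)" and free: "F \<noteq> {}"
    and harmless: "\<And>q. q \<in> F \<Longrightarrow> \<not> occupies_line L (insert q B)"
    and threat_or_subtree: "\<And>q. q \<in> F \<Longrightarrow>
      (\<exists>r \<in> F - {q}. occupies_line L (insert r (insert p A))) \<or> (\<exists>t. (q, t) \<in> set ts)"
    and subtrees: "\<And>q t. (q, t) \<in> set ts \<Longrightarrow> valid_tree P L (insert p A) (insert q B) t"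
    using "1.prems" unfolding valid_tree.simps Let_def F_def[symmetric] by fastforce+
  have "wins_moving P L (insert p A) (insert q B)" if q: "q \<in> F" for q
    using threat_or_subtree[OF q]
  proof (elim disjE bexE exE)
    fix r assume "r \<in> F - {q}" "occupies_line L (insert r (insert p A))"
    then show ?thesis
      by (intro wins_moving_wins_waiting.move[of r] wins_moving_wins_waiting.line)
        (auto simp: F_def)
  next
    fix t assume "(q, t) \<in> set ts"
    then show ?thesis using "1.IH"[OF refl refl refl _ refl] subtrees by blast
  qed
  then have "wins_waiting P L (insert p A) B"
    using free harmless unfolding F_def by (intro wins_moving_wins_waiting.reply) blast+
  then show ?case by (rule wins_moving_wins_waiting.move[OF legal])
qed

section \<open>Coordinates on affine planes\<close>

lemma affine_planeD:
  assumes "affine_plane n P L"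
  shows affine_plane_finite_points: "finite P"
    and affine_plane_card_points: "card P = n\<^sup>2"
    and affine_plane_finite_lines: "finite L"
    and affine_plane_card_lines: "card L = n * (n + 1)"
    and affine_plane_line_subset: "l \<in> L \<Longrightarrow> l \<subseteq> P"
    and affine_plane_card_line: "l \<in> L \<Longrightarrow> card l = n"
    and affine_plane_ex1_line: "x \<in> P \<Longrightarrow> y \<in> P \<Longrightarrow> x \<noteq> y \<Longrightarrow> \<exists>!l. l \<in> L \<and> x \<in> l \<and> y \<in> l"
    and affine_plane_parallelism:
      "\<exists>C. partition_on L C \<and> card C = n + 1 \<and> (\<forall>c\<in>C. partition_on P c)"
  using assms by (simp_all add: affine_plane_def)

lemma affine_plane_line_eqI:
  assumes "affine_plane n P L" and "l \<in> L" and "m \<in> L"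
    and "x \<in> l \<inter> m" and "y \<in> l \<inter> m" and "x \<noteq> y"
  shows "l = m"
proof -
  have "\<exists>!k. k \<in> L \<and> x \<in> k \<and> y \<in> k"
    using affine_plane_ex1_line[OF assms(1)] affine_plane_line_subset[OF assms(1,2)] assms(4-6)
    by blast
  then show ?thesis using assms(2-5) by blast
qed

lemma affine_plane_not_occupies_line:
  assumes plane: "affine_plane n P L" and "finite S" "card S < n"
  shows "\<not> occupies_line L S"
proof
  assume "occupies_line L S"
  then obtain l where "l \<in> L" "l \<subseteq> S" unfolding occupies_line_def by blast
  then have "n \<le> card S" using card_mono[OF \<open>finite S\<close>] affine_plane_card_line[OF plane] by metis
  then show False using \<open>card S < n\<close> by simp
qed

lemma affine_plane_ex_line_image:
  assumes plane: "affine_plane n P L" and f: "bij_betw f I P" and "x \<in> I" "y \<in> I" "x \<noteq> y"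
  shows "\<exists>M\<subseteq>I. card M = n \<and> x \<in> M \<and> y \<in> M \<and> f ` M \<in> L"
proof -
  note inj = bij_betw_imp_inj_on[OF f]
  have "f x \<noteq> f y" "f x \<in> P" "f y \<in> P"
    using assms(3-5) inj_onD[OF inj] bij_betwE[OF f] by blast+
  then obtain m where m: "m \<in> L" "f x \<in> m" "f y \<in> m"
    using affine_plane_ex1_line[OF plane, of "f x" "f y"] by blast
  let ?M = "{z \<in> I. f z \<in> m}"
  have "f ` ?M = m"
    using affine_plane_line_subset[OF plane m(1)] bij_betw_imp_surj_on[OF f] by blast
  moreover have "card (f ` ?M) = card ?M" by (intro card_image inj_on_subset[OF inj]) blast
  ultimately show ?thesis
    using assms(3,4) m affine_plane_card_line[OF plane m(1)] by (intro exI[of _ ?M]) auto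
qed

lemma affine_plane_two_le:
  assumes plane: "affine_plane n P L" and "p \<in> P" "q \<in> P" "p \<noteq> q"
  shows "2 \<le> n"
proof -
  have "{p, q} \<subseteq> P" "card {p, q} = 2" using assms(2-4) by auto
  then have "1 < n\<^sup>2"
    using card_mono[OF affine_plane_finite_points[OF plane], of "{p, q}"]
      affine_plane_card_points[OF plane] by simp
  then show ?thesis by (cases n) (auto simp: power2_eq_square)
qed

definition parallel_class :: "'a set \<Rightarrow> 'a set set \<Rightarrow> 'a set set \<Rightarrow> bool" where
  "parallel_class P L c \<longleftrightarrow> c \<subseteq> L \<and> partition_on P c"

lemma parallel_classD:
  assumes "parallel_class P L c"
  shows parallel_class_subset: "c \<subseteq> L"
    and parallel_class_Union: "\<Union> c = P"
    and parallel_class_disjoint: "l \<in> c \<Longrightarrow> m \<in> c \<Longrightarrow> x \<in> l \<Longrightarrow> x \<in> m \<Longrightarrow> l = m"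
  using assms disjointD[of c l m] unfolding parallel_class_def partition_on_def by auto

definition line_through :: "'a set set \<Rightarrow> 'a \<Rightarrow> 'a set" where
  "line_through c x = (THE l. l \<in> c \<and> x \<in> l)"

lemma line_through_eq:
  assumes "parallel_class P L c" and "l \<in> c" and "x \<in> l"
  shows "line_through c x = l"
  unfolding line_through_def
  using assms(2,3) parallel_class_disjoint[OF assms(1)] by (intro the_equality) blast+

lemma line_through:
  assumes "parallel_class P L c" and "x \<in> P"
  shows line_through_mem_class: "line_through c x \<in> c"
    and mem_line_through: "x \<in> line_through c x"
proof -
  obtain l where "l \<in> c" "x \<in> l"
    using parallel_class_Union[OF assms(1)] assms(2) by blast
  then show "line_through c x \<in> c" "x \<in> line_through c x"
    using line_through_eq[OF assms(1)] by simp_all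
qed

lemma card_parallel_class:
  assumes plane: "affine_plane n P L" and c: "parallel_class P L c"
  shows "card c = n"
proof -
  note lines = parallel_class_subset[OF c] and cover = parallel_class_Union[OF c]
  have "n * card c = card (\<Union> c)"
  proof (rule card_partition)
    show "finite c" using lines affine_plane_finite_lines[OF plane] by (rule finite_subset)
    show "finite (\<Union> c)" using affine_plane_finite_points[OF plane] by (simp add: cover)
    show "card l = n" if "l \<in> c" for l using affine_plane_card_line[OF plane] lines that by blast
    show "l \<inter> m = {}" if "l \<in> c" "m \<in> c" "l \<noteq> m" for l m
      using parallel_class_disjoint[OF c] that by blast
  qed
  then have "n * card c = n * n"
    using cover affine_plane_card_points[OF plane] by (simp add: power2_eq_square)
  moreover have "c = {}" if "n = 0"
    using lines that affine_plane_card_lines[OF plane] affine_plane_finite_lines[OF plane] by simp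
  ultimately show ?thesis by auto
qed

lemma bij_betw_line_through:
  assumes plane: "affine_plane n P L" and c: "parallel_class P L c" and l: "l \<in> L" "l \<notin> c"
  shows "bij_betw (line_through c) l c"
proof -
  have points: "x \<in> P" if "x \<in> l" for x using affine_plane_line_subset[OF plane l(1)] that by blast
  have inj: "inj_on (line_through c) l"
  proof (rule inj_onI, rule ccontr)
    fix x y assume xy: "x \<in> l" "y \<in> l" "line_through c x = line_through c y" "x \<noteq> y"
    have "l = line_through c x"
      using line_through[OF c points] parallel_class_subset[OF c] xy
      by (intro affine_plane_line_eqI[OF plane l(1) _ _ _ xy(4)]) auto
    then show False using line_through_mem_class[OF c points[OF xy(1)]] l(2) by simp
  qed
  have "finite c"
    using parallel_class_subset[OF c] affine_plane_finite_lines[OF plane] by (rule finite_subset)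
  moreover have "card (line_through c ` l) = card c"
    using card_image[OF inj] affine_plane_card_line[OF plane l(1)] card_parallel_class[OF plane c]
    by simp
  ultimately have "line_through c ` l = c"
    using line_through_mem_class[OF c points] by (intro card_subset_eq) auto
  then show ?thesis using inj by (simp add: bij_betw_def)
qed

lemma line_through_image:
  assumes "affine_plane n P L" and "parallel_class P L c" and "parallel_class P L d"
    and "c \<inter> d = {}" and "l \<in> c"
  shows "line_through d ` l = d"
proof -
  have "l \<in> L" "l \<notin> d" using assms parallel_class_subset by blast+
  then show ?thesis using bij_betw_line_through[OF assms(1,3)] bij_betw_imp_surj_on by blast
qed

lemma line_through_pair_image:
  assumes plane: "affine_plane n P L" and c: "parallel_class P L c" and d: "parallel_class P L d"
    and disj: "c \<inter> d = {}"
  shows "l \<in> c \<Longrightarrow> (\<lambda>x. (line_through c x, line_through d x)) ` l = {l} \<times> d"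
    and "m \<in> d \<Longrightarrow> (\<lambda>x. (line_through c x, line_through d x)) ` m = c \<times> {m}"
proof -
  let ?lines_at = "\<lambda>x. (line_through c x, line_through d x)"
  assume l: "l \<in> c"
  have "?lines_at ` l = Pair l ` line_through d ` l"
    unfolding image_image using line_through_eq[OF c l] by (intro image_cong) simp_all
  then show "?lines_at ` l = {l} \<times> d" using line_through_image[OF plane c d disj l] by auto
next
  let ?lines_at = "\<lambda>x. (line_through c x, line_through d x)"
  assume m: "m \<in> d"
  have "?lines_at ` m = (\<lambda>l. (l, m)) ` line_through c ` m"
    unfolding image_image using line_through_eq[OF d m] by (intro image_cong) simp_all
  moreover have "line_through c ` m = c"
    using line_through_image[OF plane d c _ m] disj by (simp add: Int_commute)
  ultimately show "?lines_at ` m = c \<times> {m}" by auto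
qed

lemma bij_betw_line_through_pair:
  assumes plane: "affine_plane n P L" and c: "parallel_class P L c" and d: "parallel_class P L d"
    and disj: "c \<inter> d = {}"
  shows "bij_betw (\<lambda>x. (line_through c x, line_through d x)) P (c \<times> d)"
proof -
  let ?lines_at = "\<lambda>x. (line_through c x, line_through d x)"
  have "inj_on ?lines_at P"
  proof (rule inj_onI)
    fix x y assume xy: "x \<in> P" "y \<in> P" "?lines_at x = ?lines_at y"
    have "line_through c x \<in> L" "line_through c x \<notin> d"
      using line_through_mem_class[OF c xy(1)] parallel_class_subset[OF c] disj by blast+
    then have "inj_on (line_through d) (line_through c x)"
      using bij_betw_line_through[OF plane d] bij_betw_imp_inj_on by blast
    moreover have "x \<in> line_through c x" "y \<in> line_through c x"
      using mem_line_through[OF c] xy by auto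
    ultimately show "x = y" using xy(3) by (auto dest: inj_onD)
  qed
  moreover have "?lines_at ` P = c \<times> d"
  proof -
    have "?lines_at ` P = (\<Union>l\<in>c. ?lines_at ` l)" using parallel_class_Union[OF c] by blast
    also have "\<dots> = (\<Union>l\<in>c. {l} \<times> d)" using line_through_pair_image(1)[OF assms] by simp
    also have "\<dots> = c \<times> d" by blast
    finally show ?thesis .
  qed
  ultimately show ?thesis unfolding bij_betw_def by blast
qed

lemma affine_plane_three_parallel_classes:
  assumes plane: "affine_plane n P L" and "2 \<le> n" and "l \<in> L"
  obtains c1 c2 c3 where "parallel_class P L c1" "parallel_class P L c2" "parallel_class P L c3"
    "l \<in> c1" "c1 \<inter> c2 = {}" "c1 \<inter> c3 = {}" "c2 \<inter> c3 = {}"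
proof -
  obtain C where C: "partition_on L C" "card C = n + 1" "\<And>c. c \<in> C \<Longrightarrow> partition_on P c"
    using affine_plane_parallelism[OF plane] by blast
  have parallel: "parallel_class P L c" if "c \<in> C" for c
    using C(1,3) that unfolding parallel_class_def partition_on_def by blast
  have disj: "c \<inter> d = {}" if "c \<in> C" "d \<in> C" "c \<noteq> d" for c d
    using disjointD[OF partition_onD2[OF C(1)] that] .
  obtain c1 where c1: "c1 \<in> C" "l \<in> c1"
    using partition_onD1[OF C(1)] \<open>l \<in> L\<close> by blast
  have "card (C - {c1}) = n" "finite (C - {c1})"
    using C(2) c1(1) card_ge_0_finite[of C] by simp_all
  then have "\<not> card (C - {c1}) \<le> Suc 0" "finite (C - {c1})" using \<open>2 \<le> n\<close> by simp_all
  then obtain c2 c3 where "c2 \<in> C - {c1}" "c3 \<in> C - {c1}" "c2 \<noteq> c3"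
    using card_le_Suc0_iff_eq[of "C - {c1}"] by blast
  then show ?thesis using that[of c1 c2 c3] c1 parallel disj by blast
qed

lemma ex_bij_betw_lessThan_card_two:
  assumes "finite A" and "a \<in> A" and "b \<in> A" and "a \<noteq> b"
  shows "\<exists>d. bij_betw d {..<card A} A \<and> d 0 = a \<and> d 1 = b"
proof -
  obtain xs where xs: "set xs = A - {a, b}" "distinct xs"
    using finite_distinct_list[of "A - {a, b}"] assms(1) by blast
  then have "set (a # b # xs) = A" "distinct (a # b # xs)" using assms by auto
  then have "bij_betw ((!) (a # b # xs)) {..<card A} A"
    using distinct_card[of "a # b # xs"] by (intro bij_betw_nth) simp_all
  then show ?thesis by (intro exI[of _ "(!) (a # b # xs)"]) simp
qed

lemma affine_plane_grid:
  assumes plane: "affine_plane n P L" and r: "parallel_class P L r" and c: "parallel_class P L c"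
    and disj: "r \<inter> c = {}" and D: "D \<in> L" "D \<notin> r" "D \<notin> c" and d: "bij_betw d {..<n} D"
  obtains f :: "nat \<times> nat \<Rightarrow> 'a" where "bij_betw f ({..<n} \<times> {..<n}) P"
    "\<And>i. i < n \<Longrightarrow> f (i, i) = d i"
    "\<And>i. i < n \<Longrightarrow> f ` ({i} \<times> {..<n}) = line_through r (d i)"
    "\<And>j. j < n \<Longrightarrow> f ` ({..<n} \<times> {j}) = line_through c (d j)"
proof -
  define lines_at where "lines_at x = (line_through r x, line_through c x)" for x
  have lines_at: "bij_betw lines_at P (r \<times> c)"
    unfolding lines_at_def by (rule bij_betw_line_through_pair[OF plane r c disj])
  define lines_of_index where "lines_of_index = map_prod (line_through r \<circ> d) (line_through c \<circ> d)"
  have rows: "bij_betw (line_through r \<circ> d) {..<n} r"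
    and cols: "bij_betw (line_through c \<circ> d) {..<n} c"
    using bij_betw_trans[OF d] bij_betw_line_through[OF plane _ D(1)] r c D(2,3) by blast+
  define f where "f = inv_into P lines_at \<circ> lines_of_index"
  have f_image: "f ` A = B" if "lines_of_index ` A = lines_at ` B" "B \<subseteq> P" for A B
    using that bij_betw_imp_inj_on[OF lines_at] by (simp add: f_def flip: image_image)
  have diag_mem: "d i \<in> P" if "i < n" for i
    using bij_betwE[OF d] affine_plane_line_subset[OF plane D(1)] that by blast
  show ?thesis
  proof (rule that)
    show "bij_betw f ({..<n} \<times> {..<n}) P"
      unfolding f_def lines_of_index_def
      using bij_betw_map_prod[OF rows cols] bij_betw_inv_into[OF lines_at]
      by (rule bij_betw_trans)
  next
    fix i assume i: "i < n"
    have row: "line_through r (d i) \<in> r" and col: "line_through c (d i) \<in> c"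
      using line_through_mem_class r c diag_mem[OF i] by fast+
    show "f (i, i) = d i"
      using f_image[of "{(i, i)}" "{d i}"] diag_mem[OF i]
      by (simp add: lines_of_index_def lines_at_def)
    show "f ` ({i} \<times> {..<n}) = line_through r (d i)"
    proof (rule f_image)
      have "lines_of_index ` ({i} \<times> {..<n}) = {line_through r (d i)} \<times> c"
        unfolding lines_of_index_def
        by (rule map_prod_surj_on[OF _ bij_betw_imp_surj_on[OF cols]]) simp
      then show "lines_of_index ` ({i} \<times> {..<n}) = lines_at ` line_through r (d i)"
        using line_through_pair_image(1)[OF plane r c disj row] by (simp add: lines_at_def)
    qed (use row r parallel_class_Union in blast)
    show "f ` ({..<n} \<times> {i}) = line_through c (d i)"
    proof (rule f_image)
      have "lines_of_index ` ({..<n} \<times> {i}) = r \<times> {line_through c (d i)}"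
        unfolding lines_of_index_def
        by (rule map_prod_surj_on[OF bij_betw_imp_surj_on[OF rows]]) simp
      then show "lines_of_index ` ({..<n} \<times> {i}) = lines_at ` line_through c (d i)"
        using line_through_pair_image(2)[OF plane r c disj col] by (simp add: lines_at_def)
    qed (use col c parallel_class_Union in blast)
  qed
qed

lemma affine_plane_frame:
  assumes plane: "affine_plane n P L" and p: "p \<in> P" and q: "q \<in> P" and "p \<noteq> q"
  obtains r c D d where "parallel_class P L r" "parallel_class P L c" "r \<inter> c = {}"
    "D \<in> L" "D \<notin> r" "D \<notin> c" "bij_betw d {..<n} D" "d 0 = p"
    "line_through r q = line_through r (d 0)" "line_through c q = line_through c (d 1)"
proof -
  obtain l where l: "l \<in> L" "p \<in> l" "q \<in> l"
    using affine_plane_ex1_line[OF plane p q \<open>p \<noteq> q\<close>] by blast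
  obtain r c s where r: "parallel_class P L r" and c: "parallel_class P L c"
    and s: "parallel_class P L s" and "l \<in> r" and disj: "r \<inter> c = {}" "r \<inter> s = {}" "c \<inter> s = {}"
    using affine_plane_three_parallel_classes[OF plane affine_plane_two_le[OF assms] l(1)] by blast
  define D where "D = line_through s p"
  have D: "D \<in> L" "D \<notin> r" "D \<notin> c" "p \<in> D"
    using line_through[OF s p] parallel_class_subset[OF s] disj unfolding D_def by auto
  have "line_through c q \<in> line_through c ` D"
    using bij_betw_line_through[OF plane c D(1,3)] line_through_mem_class[OF c q]
    by (simp add: bij_betw_def)
  then obtain u where u: "u \<in> D" "line_through c q = line_through c u" by auto
  have "inj_on (line_through c) l"
    using bij_betw_line_through[OF plane c l(1)] bij_betw_imp_inj_on \<open>l \<in> r\<close> disj(1) by blast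
  then have "u \<noteq> p" using u(2) l(2,3) \<open>p \<noteq> q\<close> by (auto dest: inj_onD)
  moreover have "finite D"
    using affine_plane_line_subset[OF plane D(1)] affine_plane_finite_points[OF plane]
    by (rule finite_subset)
  ultimately obtain d where d: "bij_betw d {..<n} D" "d 0 = p" "d 1 = u"
    using ex_bij_betw_lessThan_card_two[of D p u] D(4) u(1) affine_plane_card_line[OF plane D(1)]
    by auto
  have "line_through r q = line_through r (d 0)"
    using line_through_eq[OF r \<open>l \<in> r\<close>] l(2,3) d(2) by simp
  then show ?thesis using that[OF r c disj(1) D(1-3) d(1,2)] u(2) d(3) by simp
qed

definition grid :: "nat \<Rightarrow> (nat \<times> nat) set set" where
  "grid n = insert ((\<lambda>i. (i, i)) ` {..<n})
     ((\<lambda>i. {i} \<times> {..<n}) ` {..<n} \<union> (\<lambda>j. {..<n} \<times> {j}) ` {..<n})"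

lemma affine_plane_coordinates:
  assumes plane: "affine_plane n P L" and p: "p \<in> P" and q: "q \<in> P" and "p \<noteq> q"
  obtains f :: "nat \<times> nat \<Rightarrow> 'a" where "bij_betw f ({..<n} \<times> {..<n}) P" "f (0, 0) = p" "f (0, 1) = q"
    "\<And>g. g \<in> grid n \<Longrightarrow> f ` g \<in> L"
proof -
  have "2 \<le> n" by (rule affine_plane_two_le[OF assms])
  obtain r c D d where r: "parallel_class P L r" and c: "parallel_class P L c" and "r \<inter> c = {}"
    and D: "D \<in> L" "D \<notin> r" "D \<notin> c" and d: "bij_betw d {..<n} D" "d 0 = p"
    and q_row: "line_through r q = line_through r (d 0)"
    and q_col: "line_through c q = line_through c (d 1)"
    using affine_plane_frame[OF assms] by blast
  obtain f where f: "bij_betw f ({..<n} \<times> {..<n}) P"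
    and f_diag: "\<And>i. i < n \<Longrightarrow> f (i, i) = d i"
    and f_row: "\<And>i. i < n \<Longrightarrow> f ` ({i} \<times> {..<n}) = line_through r (d i)"
    and f_col: "\<And>j. j < n \<Longrightarrow> f ` ({..<n} \<times> {j}) = line_through c (d j)"
    using affine_plane_grid[OF plane r c \<open>r \<inter> c = {}\<close> D d(1)] by blast
  show ?thesis
  proof (rule that[OF f])
    show "f (0, 0) = p" using f_diag d(2) \<open>2 \<le> n\<close> by simp
    have "q \<in> f ` ({0} \<times> {..<n})" "q \<in> f ` ({..<n} \<times> {1})"
      using f_row[of 0] f_col[of 1] mem_line_through[OF r q] mem_line_through[OF c q] q_row q_col
        \<open>2 \<le> n\<close> by simp_all
    then show "f (0, 1) = q"
      using bij_betw_imp_inj_on[OF f] \<open>2 \<le> n\<close> by (auto dest: inj_onD)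
    have "d i \<in> P" if "i < n" for i
      using bij_betwE[OF d(1)] affine_plane_line_subset[OF plane D(1)] that by blast
    then have rows_cols: "f ` ({i} \<times> {..<n}) \<in> L" "f ` ({..<n} \<times> {i}) \<in> L" if "i < n" for i
      using f_row[OF that] f_col[OF that] line_through_mem_class r c parallel_class_subset that
      by (metis subsetD)+
    have "f ` (\<lambda>i. (i, i)) ` {..<n} = d ` {..<n}"
      unfolding image_image using f_diag by (intro image_cong) simp_all
    then have "f ` (\<lambda>i. (i, i)) ` {..<n} \<in> L"
      using bij_betw_imp_surj_on[OF d(1)] D(1) by simp
    then show "f ` g \<in> L" if "g \<in> grid n" for g
      using that rows_cols unfolding grid_def by blast
  qed
qed

section \<open>Rigidity of the plane of order 4\<close>

definition plane4 :: "nat set set" where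
  "plane4 = set (concat plane4_classes)"

lemma affine_plane_plane4: "affine_plane 4 {..<16} plane4"
  using affine_plane_4_exists unfolding plane4_def by (simp only: atLeast_upt)

lemma Union_plane4_subset: "\<Union> plane4 \<subseteq> {..<16}"
  using affine_plane_line_subset[OF affine_plane_plane4] by blast

definition encode4 :: "nat \<times> nat \<Rightarrow> nat" where
  "encode4 = (\<lambda>(i, j). 4 * i + j)"

lemma bij_betw_encode4: "bij_betw encode4 ({..<4} \<times> {..<4}) {..<16}"
  by (rule bij_betw_byWitness[where f' = "\<lambda>k. (k div 4, k mod 4)"]) (auto simp: encode4_def)

definition grid4 :: "nat set set" where
  "grid4 = insert {0, 5, 10, 15} (set (concat (take 2 plane4_classes)))"

lemma grid4_eq_image_grid: "grid4 = (`) encode4 ` grid 4"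
  by code_simp

lemma grid4_subset_plane4: "grid4 \<subseteq> plane4"
  by code_simp

definition unjoined :: "'a set set \<Rightarrow> 'a \<Rightarrow> 'a \<Rightarrow> bool" where
  "unjoined G x y \<longleftrightarrow> (\<forall>g\<in>G. x \<in> g \<longrightarrow> y \<notin> g)"

lemma affine_plane_image_line_unjoined:
  assumes plane: "affine_plane n P L" and inj: "inj_on f I"
    and M: "M \<subseteq> I" "M \<notin> G" "f ` M \<in> L" and G: "\<And>g. g \<in> G \<Longrightarrow> g \<subseteq> I" "\<And>g. g \<in> G \<Longrightarrow> f ` g \<in> L"
    and zw: "z \<in> M" "w \<in> M" "z \<noteq> w"
  shows "unjoined G z w"
  unfolding unjoined_def
proof (intro ballI impI notI)
  fix g assume g: "g \<in> G" "z \<in> g" "w \<in> g"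
  have "f z \<noteq> f w" using inj_on_contraD[OF inj zw(3)] zw M(1) by blast
  then have "f ` M = f ` g"
    using affine_plane_line_eqI[OF plane M(3) G(2)[OF g(1)], of "f z" "f w"] zw(1,2) g(2,3) by blast
  then have "M = g" using inj_on_image_eq_iff[OF inj M(1) G(1)[OF g(1)]] by blast
  then show False using M(2) g(1) by simp
qed

text \<open>
  Read as functions from rows to columns, the lines outside the grid are the 3-cycles, determined by
  their fixed point and one other point, and the double transpositions, determined by one of the two
  transpositions.
\<close>

lemma plane4_oblique_line_determined:
  "\<forall>l\<in>plane4 - grid4. \<exists>x\<in>l. \<exists>y\<in>l. unjoined grid4 x y \<and>
     (let N = Set.filter (\<lambda>a. unjoined grid4 x a \<and> unjoined grid4 y a) {..<16}
      in \<forall>a\<in>N. \<forall>b\<in>N. unjoined grid4 a b \<longrightarrow> {x, y, a, b} = l)"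
  by code_simp

lemma grid4_not_unjoined_refl: "\<forall>x\<in>{..<16}. \<not> unjoined grid4 x x"
  by code_simp

lemma image_plane4_oblique_line_mem:
  assumes plane: "affine_plane 4 P L" and f: "bij_betw f {..<16} P"
    and grid: "\<And>g. g \<in> grid4 \<Longrightarrow> f ` g \<in> L" and l: "l \<in> plane4" "l \<notin> grid4"
  shows "f ` l \<in> L"
proof -
  note plane4_line = affine_plane_line_subset[OF affine_plane_plane4]
  obtain x y where xy: "x \<in> l" "y \<in> l" "unjoined grid4 x y"
    and determined: "\<And>a b. {a, b} \<subseteq> {..<16} \<Longrightarrow> unjoined grid4 x a \<Longrightarrow> unjoined grid4 y a \<Longrightarrow>
      unjoined grid4 x b \<Longrightarrow> unjoined grid4 y b \<Longrightarrow> unjoined grid4 a b \<Longrightarrow> {x, y, a, b} = l"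
    using bspec[OF plane4_oblique_line_determined, of l] l unfolding Let_def by auto
  have xy16: "x \<in> {..<16}" "y \<in> {..<16}" using plane4_line[OF l(1)] xy by blast+
  then have "x \<noteq> y" using grid4_not_unjoined_refl xy(3) by blast
  then obtain M where M: "M \<subseteq> {..<16}" "card M = 4" "x \<in> M" "y \<in> M" and fM: "f ` M \<in> L"
    using affine_plane_ex_line_image[OF plane f xy16] by blast
  have "M \<notin> grid4" using xy(3) M(3,4) unfolding unjoined_def by blast
  moreover have "g \<subseteq> {..<16}" if "g \<in> grid4" for g
    using plane4_line grid4_subset_plane4 that by blast
  ultimately have unjoined_M: "unjoined grid4 z w" if "z \<in> M" "w \<in> M" "z \<noteq> w" for z w
    using affine_plane_image_line_unjoined[OF plane bij_betw_imp_inj_on[OF f] M(1) _ fM] grid that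
    by blast
  have "card (M - {x, y}) = 2"
    using M \<open>x \<noteq> y\<close> finite_subset[OF M(1)] by (simp add: card_Diff_subset)
  then obtain a b where ab: "M - {x, y} = {a, b}" "a \<noteq> b" by (auto simp: card_2_iff)
  then have "a \<in> M" "b \<in> M" "a \<notin> {x, y}" "b \<notin> {x, y}" by blast+
  then have "{x, y, a, b} = l"
    using M ab(2) by (intro determined unjoined_M) auto
  then have "M = l" using ab(1) M(3,4) by blast
  then show ?thesis using fM by simp
qed

lemma plane4_image_eq:
  assumes plane: "affine_plane 4 P L" and f: "bij_betw f {..<16} P"
    and grid: "\<And>g. g \<in> grid4 \<Longrightarrow> f ` g \<in> L"
  shows "(`) f ` plane4 = L"
proof (rule card_subset_eq)
  show "finite L" by (rule affine_plane_finite_lines[OF plane])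
  show "(`) f ` plane4 \<subseteq> L" using image_plane4_oblique_line_mem[OF assms] grid by blast
  have "inj_on ((`) f) plane4"
    by (intro inj_on_image inj_on_subset[OF bij_betw_imp_inj_on[OF f] Union_plane4_subset])
  then show "card ((`) f ` plane4) = card L"
    using affine_plane_card_lines[OF plane] affine_plane_card_lines[OF affine_plane_plane4]
    by (simp add: card_image)
qed

lemma affine_plane_4_iso_plane4:
  assumes plane: "affine_plane 4 P L" and "p \<in> P" "q \<in> P" "p \<noteq> q"
  obtains f :: "nat \<Rightarrow> 'a" where "bij_betw f {..<16} P" "f 0 = p" "f 1 = q" "(`) f ` plane4 = L"
proof -
  obtain f where f: "bij_betw f ({..<4} \<times> {..<4}) P" "f (0, 0) = p" "f (0, 1) = q"
    "\<And>g. g \<in> grid 4 \<Longrightarrow> f ` g \<in> L"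
    using affine_plane_coordinates[OF assms] by blast
  define decode4 where "decode4 = inv_into ({..<4} \<times> {..<4}) encode4"
  have decode: "decode4 (encode4 x) = x" if "x \<in> {..<4} \<times> {..<4}" for x
    unfolding decode4_def using bij_betw_imp_inj_on[OF bij_betw_encode4] that by (rule inv_into_f_f)
  show ?thesis
  proof (rule that)
    show bij: "bij_betw (f \<circ> decode4) {..<16} P"
      unfolding decode4_def using bij_betw_inv_into[OF bij_betw_encode4] f(1)
      by (rule bij_betw_trans)
    show "(f \<circ> decode4) 0 = p" "(f \<circ> decode4) 1 = q"
      using f(2,3) decode[of "(0, 0)"] decode[of "(0, 1)"] by (simp_all add: encode4_def)
    have "(f \<circ> decode4) ` encode4 ` g = f ` g" if "g \<in> grid 4" for g
      unfolding image_image using that decode by (intro image_cong) (auto simp: grid_def)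
    then show "(`) (f \<circ> decode4) ` plane4 = L"
      using f(4) by (intro plane4_image_eq[OF plane bij]) (auto simp: grid4_eq_image_grid)
  qed
qed

section \<open>A winning strategy after the opening 0, 1\<close>

text \<open>Found by computer search.\<close>

definition opening_trees :: "(nat \<times> nat strategy_tree) list" where
  "opening_trees =
    [(2, Node 8 [(12, Node 5 [(3, Node 6 [(7, Node 10 [(15, Node 11 [])])]), (6, Node 3 [(14,
      Node 10 [])]), (7, Node 10 [(15, Node 3 [])]), (9, Node 3 [(14, Node 10 [])]), (10, Node 7
      [(6, Node 14 [])]), (11, Node 3 [(14, Node 10 [])]), (13, Node 7 [(6, Node 14 [])]), (14,
      Node 6 [(7, Node 10 [(15, Node 13 [])])]), (15, Node 7 [(6, Node 14 [])])])]),
     (5, Node 9 [(2, Node 12 [(8, Node 6 [(3, Node 14 [(7, Node 13 [])])])]), (3, Node 2 [(15,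
      Node 7 [(14, Node 8 [])])]), (6, Node 2 [(15, Node 8 [(12, Node 7 [])])]), (7, Node 12
      [(8, Node 3 [(6, Node 15 [(2, Node 13 [])])])]), (8, Node 14 [(7, Node 13 [(2, Node 3
      [(10, Node 12 [])]), (3, Node 15 []), (6, Node 15 []), (10, Node 12 [(15, Node 6 [])]),
      (11, Node 15 []), (12, Node 10 [(3, Node 2 [])]), (15, Node 6 [(11, Node 3 [])])])]), (10,
      Node 2 [(15, Node 7 [(14, Node 8 [])])]), (11, Node 2 [(15, Node 7 [(14, Node 8 [])])]),
      (12, Node 2 [(15, Node 13 [(3, Node 7 []), (6, Node 8 [(7, Node 10 [])]), (7, Node 10 [(3,
      Node 11 [])]), (8, Node 6 [(11, Node 10 [])]), (10, Node 7 []), (11, Node 7 []), (14, Node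
      8 [(7, Node 10 [])])])]), (13, Node 2 [(15, Node 8 [(12, Node 14 [(7, Node 10 [])])])]),
      (14, Node 2 [(15, Node 8 [(12, Node 13 [(7, Node 10 [])])])]), (15, Node 7 [(14, Node 8
      [(12, Node 13 [(2, Node 11 [])])])])]),
     (6, Node 12 [(8, Node 15 [(2, Node 10 [(5, Node 13 [])]), (3, Node 2 [(9, Node 5 [])]), (5,
      Node 9 [(2, Node 14 [])]), (7, Node 2 [(9, Node 5 [])]), (9, Node 10 [(5, Node 13 [])]),
      (10, Node 9 [(2, Node 14 [])]), (11, Node 9 [(2, Node 14 [])]), (13, Node 2 [(9, Node 5
      [])]), (14, Node 2 [(9, Node 5 [])])])]),
     (8, Node 6 [(2, Node 5 [(7, Node 13 [(11, Node 10 [])])]), (3, Node 5 [(7, Node 10 [(15,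
      Node 11 [(13, Node 2 [])])])]), (5, Node 13 [(11, Node 9 [(2, Node 12 [(3, Node 14 [])]),
      (3, Node 14 [(7, Node 15 [])]), (7, Node 3 []), (10, Node 12 [(3, Node 14 [])]), (12, Node
      2 [(15, Node 10 [])]), (14, Node 3 []), (15, Node 3 [])])]), (7, Node 13 [(11, Node 10
      [(3, Node 15 [(5, Node 14 [])])])]), (9, Node 5 [(7, Node 10 [(15, Node 13 [])])]), (10,
      Node 7 [(5, Node 9 [(14, Node 3 [(12, Node 11 [])])])]), (11, Node 9 [(2, Node 7 []), (3,
      Node 7 []), (5, Node 2 [(15, Node 14 [])]), (7, Node 2 [(15, Node 3 [(12, Node 10 [])])]),
      (10, Node 7 []), (12, Node 7 []), (13, Node 7 []), (14, Node 5 [(7, Node 15 [])]), (15,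
      Node 7 [])]), (12, Node 5 [(7, Node 10 [(15, Node 13 [])])]), (13, Node 7 [(5, Node 9
      [(14, Node 3 [(12, Node 15 [])])])]), (14, Node 5 [(7, Node 10 [(15, Node 13 [])])]), (15,
      Node 7 [(5, Node 9 [(14, Node 3 [(12, Node 13 [])])])])]),
     (9, Node 5 [(2, Node 6 [(7, Node 10 [(15, Node 13 [])])]), (3, Node 6 [(7, Node 11 [(13,
      Node 12 [])])]), (6, Node 8 [(12, Node 3 [(14, Node 10 [])])]), (7, Node 8 [(12, Node 10
      [(15, Node 3 [])])]), (8, Node 6 [(7, Node 10 [(15, Node 13 [])])]), (10, Node 6 [(7, Node
      12 [(8, Node 11 [])])]), (11, Node 8 [(12, Node 3 [(14, Node 10 [])])]), (12, Node 6 [(7,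
      Node 10 [(15, Node 13 [])])]), (13, Node 6 [(7, Node 8 [(12, Node 10 [(15, Node 14
      [])])])]), (14, Node 6 [(7, Node 10 [(15, Node 13 [])])]), (15, Node 6 [(7, Node 11 [(13,
      Node 12 [])])])]),
     (10, Node 8 [(12, Node 7 [(2, Node 5 [(6, Node 14 [])]), (3, Node 2 [(13, Node 9 [])]), (5,
      Node 2 [(13, Node 9 [])]), (6, Node 2 [(13, Node 9 [])]), (9, Node 6 [(5, Node 13 [])]),
      (11, Node 2 [(13, Node 9 [])]), (13, Node 5 [(6, Node 14 [])]), (14, Node 6 [(5, Node 13
      [])]), (15, Node 5 [(6, Node 14 [])])])]),
     (11, Node 8 [(12, Node 5 [(2, Node 3 [(14, Node 10 [])]), (3, Node 7 [(6, Node 9 [(14, Node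
      2 [])])]), (6, Node 3 [(14, Node 10 [])]), (7, Node 10 [(15, Node 3 [])]), (9, Node 3
      [(14, Node 10 [])]), (10, Node 7 [(6, Node 14 [])]), (13, Node 7 [(6, Node 14 [])]), (14,
      Node 7 [(6, Node 2 [(13, Node 15 [])])]), (15, Node 7 [(6, Node 14 [])])])])]"

lemma valid_opening_trees:
  "\<forall>(q, t)\<in>set opening_trees. valid_tree {..<16} plane4 {0, 4} {1, q} t"
  by code_simp

text \<open>Squaring in the field with four elements fixes 0 and 1 and exchanges 2 and 3.\<close>

definition frobenius4 :: "nat \<Rightarrow> nat" where
  "frobenius4 k = 4 * [0, 1, 3, 2] ! (k div 4) + [0, 1, 3, 2] ! (k mod 4)"

lemma frobenius4_points: "frobenius4 ` {..<16} = {..<16}"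
  by code_simp

lemma frobenius4_lines: "(`) frobenius4 ` plane4 = plane4"
  by code_simp

lemma opening_replies_up_to_frobenius4:
  "\<forall>q\<in>{..<16} - {0, 4, 1}. \<exists>r\<in>fst ` set opening_trees. r < 16 \<and> (q = r \<or> q = frobenius4 r)"
  by code_simp

lemma wins_moving_plane4: "wins_moving {..<16} plane4 {0} {1}"
proof (rule wins_moving_wins_waiting.move[of 4])
  have inj: "inj_on frobenius4 {..<16}"
    by (intro eq_card_imp_inj_on) (simp_all only: frobenius4_points finite_lessThan)
  have "wins_moving {..<16} plane4 {4, 0} {q, 1}" if q: "q \<in> {..<16} - {0, 4, 1}" for q
  proof -
    obtain r where r: "r \<in> fst ` set opening_trees" "r < 16" "q = r \<or> q = frobenius4 r"
      using bspec[OF opening_replies_up_to_frobenius4 q] by blast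
    then obtain t where "(r, t) \<in> set opening_trees" by auto
    then have "valid_tree {..<16} plane4 {0, 4} {1, r} t" using valid_opening_trees by blast
    then have wins: "wins_moving {..<16} plane4 {0, 4} {1, r}" by (rule valid_tree_imp_wins_moving)
    have "wins_moving {..<16} plane4 {0, 4} {1, frobenius4 r}"
      using wins_image(1)[OF inj Union_plane4_subset wins] r(2)
      by (simp add: frobenius4_points frobenius4_lines) (simp add: frobenius4_def)
    then show ?thesis using wins r(3) by (auto simp: insert_commute)
  qed
  moreover have "2 \<in> {..<16} - ({4, 0} \<union> {1::nat})" by simp
  ultimately show "wins_waiting {..<16} plane4 {4, 0} {1}"
    using affine_plane_not_occupies_line[OF affine_plane_plane4]
    by (intro wins_moving_wins_waiting.reply) (blast, auto simp: card_insert_if)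
qed simp

theorem mainTheorem1:
  fixes P :: "'a set" and L :: "'a set set"
  assumes "affine_plane 4 P L"
  shows "first_player_win P L"
proof (rule first_player_win_if_wins_moving)
  note small = affine_plane_not_occupies_line[OF assms]
  show "{} \<notin> L" using small[of "{}"] by (auto simp: occupies_line_def)
  obtain p where p: "p \<in> P" using affine_plane_card_points[OF assms] by fastforce
  have "wins_moving P L {p} {q}" if q: "q \<in> P" "p \<noteq> q" for q
  proof -
    obtain f :: "nat \<Rightarrow> 'a" where f: "bij_betw f {..<16} P" "f 0 = p" "f 1 = q" "(`) f ` plane4 = L"
      using affine_plane_4_iso_plane4[OF assms p q] by blast
    then show ?thesis
      using wins_image(1)[OF _ Union_plane4_subset wins_moving_plane4, of f]
      by (simp add: bij_betw_def)
  qed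
  moreover have "P - {p} \<noteq> {}"
    using affine_plane_card_points[OF assms] by (auto simp: subset_singleton_iff)
  ultimately have "wins_waiting P L {p} {}"
    using small by (intro wins_moving_wins_waiting.reply) auto
  then show "wins_moving P L {} {}" using p by (intro wins_moving_wins_waiting.move) auto
qed

end
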